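(* Let $0<a<b<\infty$, $\alpha>0$, $\rho>0$. Let $f:[a,b]\to\mathbb{R}$ be a convex function with $f\in L[a,b]$, and put $F(x)=f(x)+f(a+b-x)$ for $x\in[a,b]$. Then $F$ is also convex and $F\in L[a,b]$. If $g:[a,b]\to\mathbb{R}$ is nonnegative and integrable, then $$ F\Big(\frac{a+b}{2}\Big)\left[ {}^\rho I^\alpha_{a+}g(b)+{}^\rho I^\alpha_{b-}g(a)\right] \leq \left[ {}^\rho I^\alpha_{a+}(gF)(b)+{}^\rho I^\alpha_{b-}(gF)(a)\right] \leq \frac{F(a)+F(b)}{2}\left[ {}^\rho I^\alpha_{a+}g(b)+{}^\rho I^\alpha_{b-}g(a)\right]. $$
   Context: The left- and right-sided Katugampola fractional integrals of order $\alpha>0$ with parameter $\rho>0$ are $$ {}^\rho I^\alpha_{a+}h(x)=\frac{\rho^{1-\alpha}}{\Gamma(\alpha)}\int_a^x\frac{t^{\rho-1}}{(x^\rho-t^\rho)^{1-\alpha}}h(t)\,dt,\qquad {}^\rho I^\alpha_{b-}h(x)=\frac{\rho^{1-\alpha}}{\Gamma(\alpha)}\int_x^b\frac{t^{\rho-1}}{(t^\rho-x^\rho)^{1-\alpha}}h(t)\,dt,$$ defined when the integrals exist (the statement is understood under this proviso of the definition); ${}^\rho I^\alpha_{a+}h(b)$ and ${}^\rho I^\alpha_{b-}h(a)$ denote their values at $x=b$ and $x=a$ respectively. $gF$ is the pointwise product. $\Gamma$ is Euler's gamma function and $L[a,b]$ is the space of Lebesgue integrable functions on $[a,b]$. *)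

theory Defs
  imports "HOL-Analysis.Analysis"
begin

text \<open>
  Katugampola fractional integrals, as Lebesgue integrals. At the single point \<open>t = x\<close> the
  kernel may be singular (or be given a conventional value by \<open>0 powr _ = 0\<close> and \<open>_ / 0 = 0\<close>);
  this is a null set. When the integrand is not integrable the library assigns the
  integral the value \<open>0\<close>, so existence is tracked by the separate predicates
  \<open>katugampola_left_exists\<close> and \<open>katugampola_right_exists\<close>.
\<close>

definition katugampola_left_integrand ::
  "real \<Rightarrow> real \<Rightarrow> (real \<Rightarrow> real) \<Rightarrow> real \<Rightarrow> real \<Rightarrow> real" where
  "katugampola_left_integrand \<rho> \<alpha> h x t =
     t powr (\<rho> - 1) / (x powr \<rho> - t powr \<rho>) powr (1 - \<alpha>) * h t"

definition katugampola_right_integrand ::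
  "real \<Rightarrow> real \<Rightarrow> (real \<Rightarrow> real) \<Rightarrow> real \<Rightarrow> real \<Rightarrow> real" where
  "katugampola_right_integrand \<rho> \<alpha> h x t =
     t powr (\<rho> - 1) / (t powr \<rho> - x powr \<rho>) powr (1 - \<alpha>) * h t"

definition katugampola_left_exists ::
  "real \<Rightarrow> real \<Rightarrow> real \<Rightarrow> (real \<Rightarrow> real) \<Rightarrow> real \<Rightarrow> bool" where
  "katugampola_left_exists \<rho> \<alpha> a h x \<longleftrightarrow>
     set_integrable lebesgue {a..x} (katugampola_left_integrand \<rho> \<alpha> h x)"

definition katugampola_right_exists ::
  "real \<Rightarrow> real \<Rightarrow> real \<Rightarrow> (real \<Rightarrow> real) \<Rightarrow> real \<Rightarrow> bool" where
  "katugampola_right_exists \<rho> \<alpha> b h x \<longleftrightarrow>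
     set_integrable lebesgue {x..b} (katugampola_right_integrand \<rho> \<alpha> h x)"

definition katugampola_left ::
  "real \<Rightarrow> real \<Rightarrow> real \<Rightarrow> (real \<Rightarrow> real) \<Rightarrow> real \<Rightarrow> real" where
  "katugampola_left \<rho> \<alpha> a h x =
     \<rho> powr (1 - \<alpha>) / Gamma \<alpha> *
       (LINT t:{a..x}|lebesgue. katugampola_left_integrand \<rho> \<alpha> h x t)"

definition katugampola_right ::
  "real \<Rightarrow> real \<Rightarrow> real \<Rightarrow> (real \<Rightarrow> real) \<Rightarrow> real \<Rightarrow> real" where
  "katugampola_right \<rho> \<alpha> b h x =
     \<rho> powr (1 - \<alpha>) / Gamma \<alpha> *
       (LINT t:{x..b}|lebesgue. katugampola_right_integrand \<rho> \<alpha> h x t)"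

end

theory Submission
  imports Defs
begin

text \<open>
  \<open>F\<close> is symmetric about the midpoint, so convexity squeezes it between its value at the
  midpoint and its common value at the two endpoints. Integrating these pointwise bounds against
  \<open>g\<close> times each of the two nonnegative Katugampola kernels gives the two inequalities.
\<close>

text \<open>The reflection is affine and maps the interval to itself, so it carries convex
  combinations to convex combinations with the same weights.\<close>

lemma convex_on_reflect_Icc:
  fixes f :: "real \<Rightarrow> real"
  assumes "convex_on {a..b} f"
  shows "convex_on {a..b} (\<lambda>x. f (a + b - x))"
proof (rule convex_onI)
  fix t x y :: real
  assume "t > 0" "t < 1" "x \<in> {a..b}" "y \<in> {a..b}"
  then have "f ((1 - t) *\<^sub>R (a + b - x) + t *\<^sub>R (a + b - y))
      \<le> (1 - t) * f (a + b - x) + t * f (a + b - y)"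
    by (intro convex_onD[OF assms]) auto
  moreover have "(1 - t) *\<^sub>R (a + b - x) + t *\<^sub>R (a + b - y)
      = a + b - ((1 - t) *\<^sub>R x + t *\<^sub>R y)"
    by (simp add: algebra_simps)
  ultimately show "f (a + b - ((1 - t) *\<^sub>R x + t *\<^sub>R y))
      \<le> (1 - t) * f (a + b - x) + t * f (a + b - y)"
    by simp
qed simp

text \<open>A change of variables along the reflection, which is injective, has derivative -1 and
  has the interval as its own image.\<close>

lemma set_integrable_reflect_Icc:
  fixes f :: "real \<Rightarrow> real"
  assumes "set_integrable lebesgue {a..b} f"
  shows "set_integrable lebesgue {a..b} (\<lambda>x. f (a + b - x))"
proof -
  have image: "(\<lambda>x. a + b - x) ` {a..b} = {a..b}"
    by (simp add: image_diff_atLeastAtMost)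
  \<comment> \<open>The factor \<open>\<bar>- 1\<bar>\<close> is the Jacobian, left unevaluated to
    match the change of variables rule.\<close>
  have "f absolutely_integrable_on (\<lambda>x. a + b - x) ` {a..b} \<longleftrightarrow>
      (\<lambda>x. \<bar>- 1\<bar> * f (a + b - x)) absolutely_integrable_on {a..b}"
    by (rule absolutely_integrable_change_of_variables_1')
       (auto intro!: derivative_eq_intros simp: inj_on_def)
  then show ?thesis
    using assms by (simp add: image)
qed

text \<open>The centre is the midpoint of \<open>t\<close> and its mirror image, where
  \<open>F\<close> takes equal values; this gives the lower bound. The upper bound is the chord over
  the whole interval, which symmetry makes horizontal.\<close>

lemma convex_on_symmetric_Icc_bounds:
  fixes F :: "real \<Rightarrow> real"
  assumes convex: "convex_on {a..b} F"
    and sym: "\<And>x. x \<in> {a..b} \<Longrightarrow> F (a + b - x) = F x"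
    and t: "t \<in> {a..b}"
  shows "F ((a + b) / 2) \<le> F t" and "F t \<le> F a"
proof -
  have "F ((1 - 1/2) *\<^sub>R t + (1/2) *\<^sub>R (a + b - t)) \<le> (1 - 1/2) * F t + 1/2 * F (a + b - t)"
    using t by (intro convex_onD[OF convex]) auto
  moreover have "(1 - 1/2) *\<^sub>R t + (1/2) *\<^sub>R (a + b - t) = (a + b) / 2"
    by (simp add: field_simps)
  ultimately have "F ((a + b) / 2) \<le> (1 - 1/2) * F t + 1/2 * F (a + b - t)"
    by (simp only:)
  then show "F ((a + b) / 2) \<le> F t"
    by (simp add: sym[OF t])
  \<comment> \<open>Symmetry at the endpoint \<open>b\<close>, which lies in the interval because
    \<open>t\<close> shows it to be nonempty.\<close>
  have "F a = F b"
    using sym[of b] t by simp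
  then show "F t \<le> F a"
    using convex_onD_Icc'[OF convex t] by simp
qed

text \<open>Multiply the pointwise bounds by the nonnegative weight and integrate. Integrability of
  the product is assumed, in keeping with the proviso that the fractional integrals exist.\<close>

lemma set_integral_weighted_bounds:
  fixes w F :: "'a \<Rightarrow> real"
  assumes w: "set_integrable M A w" and wF: "set_integrable M A (\<lambda>t. w t * F t)"
    and nonneg: "\<And>t. t \<in> A \<Longrightarrow> 0 \<le> w t"
    and bounds: "\<And>t. t \<in> A \<Longrightarrow> m \<le> F t" "\<And>t. t \<in> A \<Longrightarrow> F t \<le> K"
  shows "m * (LINT t:A|M. w t) \<le> (LINT t:A|M. w t * F t)"
    and "(LINT t:A|M. w t * F t) \<le> K * (LINT t:A|M. w t)"
proof -
  have "(LINT t:A|M. m * w t) \<le> (LINT t:A|M. w t * F t)"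
    using w wF nonneg bounds
    by (intro set_integral_mono) (auto simp: mult.commute[of m] mult_left_mono)
  then show "m * (LINT t:A|M. w t) \<le> (LINT t:A|M. w t * F t)"
    by simp
  have "(LINT t:A|M. w t * F t) \<le> (LINT t:A|M. K * w t)"
    using w wF nonneg bounds
    by (intro set_integral_mono) (auto simp: mult.commute[of K] mult_left_mono)
  then show "(LINT t:A|M. w t * F t) \<le> K * (LINT t:A|M. w t)"
    by simp
qed

text \<open>The weighted bounds with weight kernel times \<open>g\<close>, rescaled by a factor that
  is nonnegative because \<Gamma> is nonnegative at positive arguments.\<close>

lemma katugampola_left_weighted_bounds:
  assumes "\<alpha> > 0"
    and "katugampola_left_exists \<rho> \<alpha> a g x"
    and "katugampola_left_exists \<rho> \<alpha> a (\<lambda>t. g t * F t) x"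
    and "\<And>t. t \<in> {a..x} \<Longrightarrow> 0 \<le> g t"
    and "\<And>t. t \<in> {a..x} \<Longrightarrow> m \<le> F t" "\<And>t. t \<in> {a..x} \<Longrightarrow> F t \<le> K"
  shows "m * katugampola_left \<rho> \<alpha> a g x \<le> katugampola_left \<rho> \<alpha> a (\<lambda>t. g t * F t) x"
    and "katugampola_left \<rho> \<alpha> a (\<lambda>t. g t * F t) x \<le> K * katugampola_left \<rho> \<alpha> a g x"
proof -
  define c where "c = \<rho> powr (1 - \<alpha>) / Gamma \<alpha>"
  have c: "0 \<le> c"
    using assms(1) by (simp add: c_def Gamma_real_nonneg)
  let ?w = "katugampola_left_integrand \<rho> \<alpha> g x"
  have prod: "katugampola_left_integrand \<rho> \<alpha> (\<lambda>t. g t * F t) x = (\<lambda>t. ?w t * F t)"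
    by (simp add: katugampola_left_integrand_def fun_eq_iff)
  note integrable = assms(2,3)[unfolded katugampola_left_exists_def prod]
  \<comment> \<open>Values of \<open>powr\<close> are never negative, so the weight is nonnegative
    on the closed interval, including \<open>t = x\<close>, where the quotient takes the
    conventional value 0.\<close>
  have bounds: "m * (LINT t:{a..x}|lebesgue. ?w t) \<le> (LINT t:{a..x}|lebesgue. ?w t * F t)"
      "(LINT t:{a..x}|lebesgue. ?w t * F t) \<le> K * (LINT t:{a..x}|lebesgue. ?w t)"
    using set_integral_weighted_bounds[OF integrable _ assms(5,6)] assms(4)
    by (simp_all add: katugampola_left_integrand_def)
  show "m * katugampola_left \<rho> \<alpha> a g x \<le> katugampola_left \<rho> \<alpha> a (\<lambda>t. g t * F t) x"
    "katugampola_left \<rho> \<alpha> a (\<lambda>t. g t * F t) x \<le> K * katugampola_left \<rho> \<alpha> a g x"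
    using bounds[THEN mult_left_mono, OF c]
    by (simp_all add: katugampola_left_def prod c_def mult.left_commute)
qed

text \<open>The mirror image of the left-sided case: only the kernel and the interval of integration
  change.\<close>

lemma katugampola_right_weighted_bounds:
  assumes "\<alpha> > 0"
    and "katugampola_right_exists \<rho> \<alpha> b g x"
    and "katugampola_right_exists \<rho> \<alpha> b (\<lambda>t. g t * F t) x"
    and "\<And>t. t \<in> {x..b} \<Longrightarrow> 0 \<le> g t"
    and "\<And>t. t \<in> {x..b} \<Longrightarrow> m \<le> F t" "\<And>t. t \<in> {x..b} \<Longrightarrow> F t \<le> K"
  shows "m * katugampola_right \<rho> \<alpha> b g x \<le> katugampola_right \<rho> \<alpha> b (\<lambda>t. g t * F t) x"
    and "katugampola_right \<rho> \<alpha> b (\<lambda>t. g t * F t) x \<le> K * katugampola_right \<rho> \<alpha> b g x"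
proof -
  define c where "c = \<rho> powr (1 - \<alpha>) / Gamma \<alpha>"
  have c: "0 \<le> c"
    using assms(1) by (simp add: c_def Gamma_real_nonneg)
  let ?w = "katugampola_right_integrand \<rho> \<alpha> g x"
  have prod: "katugampola_right_integrand \<rho> \<alpha> (\<lambda>t. g t * F t) x = (\<lambda>t. ?w t * F t)"
    by (simp add: katugampola_right_integrand_def fun_eq_iff)
  note integrable = assms(2,3)[unfolded katugampola_right_exists_def prod]
  have bounds: "m * (LINT t:{x..b}|lebesgue. ?w t) \<le> (LINT t:{x..b}|lebesgue. ?w t * F t)"
      "(LINT t:{x..b}|lebesgue. ?w t * F t) \<le> K * (LINT t:{x..b}|lebesgue. ?w t)"
    using set_integral_weighted_bounds[OF integrable _ assms(5,6)] assms(4)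
    by (simp_all add: katugampola_right_integrand_def)
  show "m * katugampola_right \<rho> \<alpha> b g x \<le> katugampola_right \<rho> \<alpha> b (\<lambda>t. g t * F t) x"
    "katugampola_right \<rho> \<alpha> b (\<lambda>t. g t * F t) x \<le> K * katugampola_right \<rho> \<alpha> b g x"
    using bounds[THEN mult_left_mono, OF c]
    by (simp_all add: katugampola_right_def prod c_def mult.left_commute)
qed

theorem theorem3p8:
  fixes a b \<alpha> \<rho> :: real and f F :: "real \<Rightarrow> real"
  assumes "0 < a" and "a < b" and "\<alpha> > 0" and "\<rho> > 0"
    and "convex_on {a..b} f"
    and "set_integrable lebesgue {a..b} f"
    and "\<And>x. x \<in> {a..b} \<Longrightarrow> F x = f x + f (a + b - x)"
  shows "convex_on {a..b} F \<and> set_integrable lebesgue {a..b} F \<and>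
    (\<forall>g :: real \<Rightarrow> real.
      (\<forall>x\<in>{a..b}. 0 \<le> g x) \<longrightarrow>
      set_integrable lebesgue {a..b} g \<longrightarrow>
      katugampola_left_exists \<rho> \<alpha> a g b \<longrightarrow>
      katugampola_right_exists \<rho> \<alpha> b g a \<longrightarrow>
      katugampola_left_exists \<rho> \<alpha> a (\<lambda>t. g t * F t) b \<longrightarrow>
      katugampola_right_exists \<rho> \<alpha> b (\<lambda>t. g t * F t) a \<longrightarrow>
        F ((a + b) / 2) * (katugampola_left \<rho> \<alpha> a g b + katugampola_right \<rho> \<alpha> b g a)
          \<le> katugampola_left \<rho> \<alpha> a (\<lambda>t. g t * F t) b
             + katugampola_right \<rho> \<alpha> b (\<lambda>t. g t * F t) a \<and>
        katugampola_left \<rho> \<alpha> a (\<lambda>t. g t * F t) b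
             + katugampola_right \<rho> \<alpha> b (\<lambda>t. g t * F t) a
          \<le> (F a + F b) / 2 *
             (katugampola_left \<rho> \<alpha> a g b + katugampola_right \<rho> \<alpha> b g a))"
proof -
  have sum_convex: "convex_on {a..b} (\<lambda>x. f x + f (a + b - x))"
    using assms(5) by (intro convex_on_add convex_on_reflect_Icc)
  \<comment> \<open>\<open>F\<close> is known to equal the sum only on the interval, so the convex
    combination must be shown to stay inside before the values can be replaced.\<close>
  have F_convex: "convex_on {a..b} F"
  proof (rule convex_onI)
    fix t x y :: real
    assume "t > 0" "t < 1" and xy: "x \<in> {a..b}" "y \<in> {a..b}"
    moreover from this have "(1 - t) *\<^sub>R x + t *\<^sub>R y \<in> {a..b}"
      by (intro convexD) auto
    ultimately show "F ((1 - t) *\<^sub>R x + t *\<^sub>R y) \<le> (1 - t) * F x + t * F y"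
      using convex_onD[OF sum_convex, of t x y] by (simp add: assms(7))
  qed simp
  have sum_integrable: "set_integrable lebesgue {a..b} (\<lambda>x. f x + f (a + b - x))"
    using assms(6) by (intro set_integral_add set_integrable_reflect_Icc)
  have F_integrable: "set_integrable lebesgue {a..b} F"
    by (rule set_integrable_cong[THEN iffD2, OF refl refl _ sum_integrable]) (use assms(7) in auto)
  have sym: "F (a + b - x) = F x" if "x \<in> {a..b}" for x
    using that by (simp add: assms(7))
  \<comment> \<open>The endpoint mean in the goal becomes the one-endpoint bound delivered by
    \<open>F_bounds\<close>.\<close>
  have ends: "(F a + F b) / 2 = F a"
    using sym[of b] \<open>a < b\<close> by simp
  note F_bounds = convex_on_symmetric_Icc_bounds[OF F_convex sym]
  show ?thesis
  proof (intro conjI allI impI)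
    fix g :: "real \<Rightarrow> real"
    assume nonneg: "\<forall>x\<in>{a..b}. 0 \<le> g x"
      and left: "katugampola_left_exists \<rho> \<alpha> a g b"
        "katugampola_left_exists \<rho> \<alpha> a (\<lambda>t. g t * F t) b"
      and right: "katugampola_right_exists \<rho> \<alpha> b g a"
        "katugampola_right_exists \<rho> \<alpha> b (\<lambda>t. g t * F t) a"
    \<comment> \<open>Evaluated at \<open>b\<close> on the left and at \<open>a\<close> on the
      right, both integrals run over all of \<open>{a..b}\<close>, so the same two constants bound
      \<open>F\<close> in each and the inequalities can be added.\<close>
    note left_bounds = katugampola_left_weighted_bounds
      [OF \<open>\<alpha> > 0\<close> left nonneg[rule_format] F_bounds]
    note right_bounds = katugampola_right_weighted_bounds
      [OF \<open>\<alpha> > 0\<close> right nonneg[rule_format] F_bounds]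
    show "F ((a + b) / 2) * (katugampola_left \<rho> \<alpha> a g b + katugampola_right \<rho> \<alpha> b g a)
        \<le> katugampola_left \<rho> \<alpha> a (\<lambda>t. g t * F t) b
           + katugampola_right \<rho> \<alpha> b (\<lambda>t. g t * F t) a"
      unfolding distrib_left by (intro add_mono left_bounds right_bounds)
    show "katugampola_left \<rho> \<alpha> a (\<lambda>t. g t * F t) b
           + katugampola_right \<rho> \<alpha> b (\<lambda>t. g t * F t) a
        \<le> (F a + F b) / 2 *
           (katugampola_left \<rho> \<alpha> a g b + katugampola_right \<rho> \<alpha> b g a)"
      unfolding ends distrib_left by (intro add_mono left_bounds right_bounds)
  qed (fact F_convex F_integrable)+
qed

end
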